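(* Let $L_1,L_2,L_3$ be distinct non-null lines such that the points $L_1L_2$ and $L_1L_3$ are non-null. Let $S_1\equiv S(L_2,L_3)$, $S_2\equiv S(L_1,L_3)$, $S_3\equiv S(L_1,L_2)$ be the spreads and $q_1\equiv q(L_1L_2,L_1L_3)$ the quadrance. Then $$(S_2S_3q_1-S_1-S_2-S_3+2)^2=4(1-S_1)(1-S_2)(1-S_3).$$
   Context: Let $\mathbb F$ be a field of characteristic not two. A 3-proportion $x:y:z$ is a triple of elements of $\mathbb F$, not all zero, up to a common non-zero scalar. A point $a=[x:y:z]$ and a line $L=(l:m:n)$ are both 3-proportions. The point $[x:y:z]$ lies on the line $(l:m:n)$ when $lx+my-nz=0$. For distinct lines $L,M$, the meet $LM$ is the unique point lying on both. A point $[x:y:z]$ is null when $x^2+y^2-z^2=0$; a line $(l:m:n)$ is null when $l^2+m^2-n^2=0$. The quadrance between non-null points $a_1=[x_1:y_1:z_1]$, $a_2=[x_2:y_2:z_2]$ is $$q(a_1,a_2)=1-\frac{(x_1x_2+y_1y_2-z_1z_2)^2}{(x_1^2+y_1^2-z_1^2)(x_2^2+y_2^2-z_2^2)}.$$ The spread between non-null lines $L_1=(l_1:m_1:n_1)$, $L_2=(l_2:m_2:n_2)$ is $$S(L_1,L_2)=1-\frac{(l_1l_2+m_1m_2-n_1n_2)^2}{(l_1^2+m_1^2-n_1^2)(l_2^2+m_2^2-n_2^2)}.$$ Quadrances involving null points and spreads involving null lines are undefined. *)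

theory Defs
  imports "HOL-Computational_Algebra.Polynomial"
begin

definition proportional :: "'a::field \<times> 'a \<times> 'a \<Rightarrow> 'a \<times> 'a \<times> 'a \<Rightarrow> bool" where
  "proportional = (\<lambda>(x\<^sub>1, y\<^sub>1, z\<^sub>1) (x\<^sub>2, y\<^sub>2, z\<^sub>2).
     (x\<^sub>1, y\<^sub>1, z\<^sub>1) \<noteq> (0, 0, 0) \<and> (x\<^sub>2, y\<^sub>2, z\<^sub>2) \<noteq> (0, 0, 0) \<and>
     (\<exists>c. c \<noteq> 0 \<and> x\<^sub>2 = c * x\<^sub>1 \<and> y\<^sub>2 = c * y\<^sub>1 \<and> z\<^sub>2 = c * z\<^sub>1))"

lemma part_equivp_proportional: "part_equivp (proportional :: 'a::field \<times> 'a \<times> 'a \<Rightarrow> _)"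
proof (rule part_equivpI)
  show "\<exists>v :: 'a \<times> 'a \<times> 'a. proportional v v"
    by (rule exI [of _ "(1, 0, 0)"]) (auto simp: proportional_def)
  show "symp (proportional :: 'a \<times> 'a \<times> 'a \<Rightarrow> _)"
  proof (rule sympI)
    fix u v :: "'a \<times> 'a \<times> 'a"
    assume "proportional u v"
    then obtain c where "c \<noteq> 0" "u \<noteq> (0, 0, 0)" "v \<noteq> (0, 0, 0)"
      "fst v = c * fst u" "fst (snd v) = c * fst (snd u)" "snd (snd v) = c * snd (snd u)"
      by (auto simp: proportional_def split: prod.splits)
    then show "proportional v u"
      by (auto simp: proportional_def split: prod.splits intro!: exI [of _ "inverse c"])
  qed
  show "transp (proportional :: 'a \<times> 'a \<times> 'a \<Rightarrow> _)"
  proof (rule transpI)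
    fix u v w :: "'a \<times> 'a \<times> 'a"
    assume "proportional u v" and "proportional v w"
    then obtain c d where "c \<noteq> 0" "d \<noteq> 0" "u \<noteq> (0, 0, 0)" "w \<noteq> (0, 0, 0)"
      "fst v = c * fst u" "fst (snd v) = c * fst (snd u)" "snd (snd v) = c * snd (snd u)"
      "fst w = d * fst v" "fst (snd w) = d * fst (snd v)" "snd (snd w) = d * snd (snd v)"
      by (auto simp: proportional_def split: prod.splits)
    then show "proportional u w"
      by (auto simp: proportional_def split: prod.splits intro!: exI [of _ "d * c"])
  qed
qed

quotient_type (overloaded) 'a proportion = "'a::field \<times> 'a \<times> 'a" / partial: proportional
  by (rule part_equivp_proportional)

type_synonym 'a point = "'a proportion"
type_synonym 'a line = "'a proportion"

lift_definition lies_on :: "'a::field point \<Rightarrow> 'a line \<Rightarrow> bool"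
  is "\<lambda>(x, y, z) (l, m, n). l * x + m * y - n * z = 0"
proof -
  fix a a' L L' :: "'a \<times> 'a \<times> 'a"
  assume "proportional a a'" and "proportional L L'"
  then obtain c d x y z l m n where cd: "c \<noteq> 0" "d \<noteq> 0"
    and eqs: "a = (x, y, z)" "a' = (c * x, c * y, c * z)"
      "L = (l, m, n)" "L' = (d * l, d * m, d * n)"
    by (auto simp: proportional_def split: prod.splits)
  have "d * l * (c * x) + d * m * (c * y) - d * n * (c * z)
      = (c * d) * (l * x + m * y - n * z)"
    by (simp add: algebra_simps)
  then show "(case a of (x, y, z) \<Rightarrow> \<lambda>(l, m, n). l * x + m * y - n * z = 0) L
      \<longleftrightarrow> (case a' of (x, y, z) \<Rightarrow> \<lambda>(l, m, n). l * x + m * y - n * z = 0) L'"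
    using cd by (simp add: eqs del: right_minus_eq)
qed

lemma proportional_if_cross_zero:
  fixes x y z l m n :: "'a::field"
  assumes "(x, y, z) \<noteq> (0, 0, 0)" and "(l, m, n) \<noteq> (0, 0, 0)"
    and "x * m = y * l" and "y * n = z * m" and "z * l = x * n"
  shows "proportional (x, y, z) (l, m, n)"
proof -
  consider "x \<noteq> 0" | "x = 0" "y \<noteq> 0" | "x = 0" "y = 0" "z \<noteq> 0"
    using assms(1) by auto
  then have "\<exists>c. l = c * x \<and> m = c * y \<and> n = c * z"
  proof cases
    case 1
    then show ?thesis
      using assms by (intro exI [of _ "l / x"]) (auto simp: field_simps)
  next
    case 2
    then show ?thesis
      using assms by (intro exI [of _ "m / y"]) (auto simp: field_simps)
  next
    case 3
    then show ?thesis
      using assms by (intro exI [of _ "n / z"]) (auto simp: field_simps)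
  qed
  then obtain c where c: "l = c * x" "m = c * y" "n = c * z"
    by blast
  with assms(2) have "c \<noteq> 0"
    by auto
  with c assms(1,2) show ?thesis
    by (auto simp: proportional_def)
qed

lemma ex1_meet:
  fixes L M :: "'a::field line"
  assumes "L \<noteq> M"
  shows "\<exists>!a. lies_on a L \<and> lies_on a M"
  using assms unfolding Ex1_def
proof transfer
  fix L M :: "'a \<times> 'a \<times> 'a"
  assume LL: "proportional L L" and MM: "proportional M M" and LM: "\<not> proportional L M"
  obtain l\<^sub>1 m\<^sub>1 n\<^sub>1 l\<^sub>2 m\<^sub>2 n\<^sub>2 where L: "L = (l\<^sub>1, m\<^sub>1, n\<^sub>1)" and M: "M = (l\<^sub>2, m\<^sub>2, n\<^sub>2)"
    by (cases L, cases M) auto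
  define x y z where "x = m\<^sub>1 * n\<^sub>2 - n\<^sub>1 * m\<^sub>2" and "y = n\<^sub>1 * l\<^sub>2 - l\<^sub>1 * n\<^sub>2"
    and "z = m\<^sub>1 * l\<^sub>2 - l\<^sub>1 * m\<^sub>2"
  note xyz = this
  have "L \<noteq> (0, 0, 0)" "M \<noteq> (0, 0, 0)"
    using LL MM by (auto simp: proportional_def)
  then have nz: "(x, y, z) \<noteq> (0, 0, 0)"
    using LM proportional_if_cross_zero [of l\<^sub>1 m\<^sub>1 n\<^sub>1 l\<^sub>2 m\<^sub>2 n\<^sub>2]
    by (auto simp: L M xyz algebra_simps)
  let ?on = "\<lambda>(x, y, z) (l, m, n). l * x + m * y - n * z = (0::'a)"
  have on: "?on (x, y, z) L" "?on (x, y, z) M"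
    by (simp_all add: L M xyz algebra_simps)
  have uniq: "proportional (u, v, w) (x, y, z)"
    if "(u, v, w) \<noteq> (0, 0, 0)" "?on (u, v, w) L" "?on (u, v, w) M" for u v w
  proof -
    have h: "l\<^sub>1 * u + m\<^sub>1 * v - n\<^sub>1 * w = 0" "l\<^sub>2 * u + m\<^sub>2 * v - n\<^sub>2 * w = 0"
      using that by (simp_all add: L M)
    have "u * y - v * x = n\<^sub>1 * (l\<^sub>2 * u + m\<^sub>2 * v - n\<^sub>2 * w) - n\<^sub>2 * (l\<^sub>1 * u + m\<^sub>1 * v - n\<^sub>1 * w)"
      "v * z - w * y = l\<^sub>2 * (l\<^sub>1 * u + m\<^sub>1 * v - n\<^sub>1 * w) - l\<^sub>1 * (l\<^sub>2 * u + m\<^sub>2 * v - n\<^sub>2 * w)"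
      "w * x - u * z = m\<^sub>2 * (l\<^sub>1 * u + m\<^sub>1 * v - n\<^sub>1 * w) - m\<^sub>1 * (l\<^sub>2 * u + m\<^sub>2 * v - n\<^sub>2 * w)"
      by (simp_all add: xyz algebra_simps)
    then show ?thesis
      by (intro proportional_if_cross_zero that(1) nz) (simp_all add: h)
  qed
  show "\<exists>a\<in>Collect (\<lambda>a. proportional a a). (?on a L \<and> ?on a M) \<and>
    (\<forall>b\<in>Collect (\<lambda>a. proportional a a). ?on b L \<and> ?on b M \<longrightarrow> proportional b a)"
    using nz on uniq by (intro bexI [of _ "(x, y, z)"]) (auto simp: proportional_def intro!: exI [of _ 1])
qed

text \<open>Meaningful only for distinct lines, where the common point exists and is unique
  (lemma \<open>ex1_meet\<close>).\<close>

definition meet :: "'a::field line \<Rightarrow> 'a line \<Rightarrow> 'a point" where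
  "meet L M = (THE a. lies_on a L \<and> lies_on a M)"

definition bform :: "'a::field \<times> 'a \<times> 'a \<Rightarrow> 'a \<times> 'a \<times> 'a \<Rightarrow> 'a" where
  "bform = (\<lambda>(x\<^sub>1, y\<^sub>1, z\<^sub>1) (x\<^sub>2, y\<^sub>2, z\<^sub>2). x\<^sub>1 * x\<^sub>2 + y\<^sub>1 * y\<^sub>2 - z\<^sub>1 * z\<^sub>2)"

lemma bform_proportional:
  assumes "proportional u u'" and "proportional v v'"
  obtains c d where "c \<noteq> 0" "d \<noteq> 0" "bform u' u' = c\<^sup>2 * bform u u"
    "bform v' v' = d\<^sup>2 * bform v v" "bform u' v' = c * d * bform u v"
proof -
  obtain x y z l m n where uv: "u = (x, y, z)" "v = (l, m, n)"
    by (cases u, cases v) auto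
  obtain c where c: "c \<noteq> 0" "u' = (c * x, c * y, c * z)"
    using assms(1) by (auto simp: proportional_def uv)
  obtain d where d: "d \<noteq> 0" "v' = (d * l, d * m, d * n)"
    using assms(2) by (auto simp: proportional_def uv)
  show thesis
    by (rule that [OF c(1) d(1)])
       (simp_all add: uv c(2) d(2) bform_def power2_eq_square algebra_simps)
qed

lemma bform_ratio_proportional:
  assumes "proportional u u'" and "proportional v v'"
  shows "1 - (bform u v)\<^sup>2 / (bform u u * bform v v)
       = 1 - (bform u' v')\<^sup>2 / (bform u' u' * bform v' v')"
proof -
  obtain c d where cd: "c \<noteq> 0" "d \<noteq> 0" "bform u' u' = c\<^sup>2 * bform u u"
    "bform v' v' = d\<^sup>2 * bform v v" "bform u' v' = c * d * bform u v"
    using assms by (rule bform_proportional)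
  have "(bform u' v')\<^sup>2 / (bform u' u' * bform v' v')
      = ((c * d)\<^sup>2 * (bform u v)\<^sup>2) / ((c * d)\<^sup>2 * (bform u u * bform v v))"
    by (simp add: cd(3-5) power_mult_distrib algebra_simps)
  then show ?thesis
    using cd(1,2) by simp
qed

text \<open>Points and lines are both proportions, and nullity is given by the same equation for both.\<close>

lift_definition null :: "'a::field proportion \<Rightarrow> bool"
  is "\<lambda>(x, y, z). x\<^sup>2 + y\<^sup>2 - z\<^sup>2 = 0"
proof -
  fix u v :: "'a \<times> 'a \<times> 'a"
  assume "proportional u v"
  then obtain c where "c \<noteq> 0" "bform v v = c\<^sup>2 * bform u u"
    using bform_proportional by metis
  moreover have "(case w of (x, y, z) \<Rightarrow> x\<^sup>2 + y\<^sup>2 - z\<^sup>2 = 0) \<longleftrightarrow> bform w w = 0" for w :: "'a \<times> 'a \<times> 'a"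
    by (simp add: bform_def power2_eq_square split: prod.splits)
  ultimately show "(case u of (x, y, z) \<Rightarrow> x\<^sup>2 + y\<^sup>2 - z\<^sup>2 = 0)
      \<longleftrightarrow> (case v of (x, y, z) \<Rightarrow> x\<^sup>2 + y\<^sup>2 - z\<^sup>2 = 0)"
    by simp
qed

text \<open>Quadrance is meaningful only for non-null points and spread only for non-null lines; a null
  argument yields the junk value 1, because division by zero is zero.\<close>

lift_definition quadrance :: "'a::field point \<Rightarrow> 'a point \<Rightarrow> 'a"
  is "\<lambda>a\<^sub>1 a\<^sub>2. 1 - (bform a\<^sub>1 a\<^sub>2)\<^sup>2 / (bform a\<^sub>1 a\<^sub>1 * bform a\<^sub>2 a\<^sub>2)"
  by (rule bform_ratio_proportional)

lift_definition spread :: "'a::field line \<Rightarrow> 'a line \<Rightarrow> 'a"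
  is "\<lambda>L\<^sub>1 L\<^sub>2. 1 - (bform L\<^sub>1 L\<^sub>2)\<^sup>2 / (bform L\<^sub>1 L\<^sub>1 * bform L\<^sub>2 L\<^sub>2)"
  by (rule bform_ratio_proportional)

end

(* Represent the lines by vectors u, v, w, the meets by Lorentzian cross products, and write a, b, c
  for the values of the form at u, v, w and d, e, f for its values at (u, v), (u, w), (v, w). The
  Binet-Cauchy identity gives S3 = (a b - d^2)/(a b), S2 = (a c - e^2)/(a c) and
  q1 = 1 - (a f - d e)^2 / ((a b - d^2)(a c - e^2)), so that
  S2 S3 q1 - S1 - S2 - S3 + 2 = 2 d e f / (a b c). *)

theory Submission
  imports Defs
begin

text \<open>The Euclidean cross product with its last coordinate negated, to match the signature of
  \<open>bform\<close>: the result is orthogonal to both factors for \<open>bform\<close>, so it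
  represents the meet of two lines.\<close>

definition lorentz_cross :: "'a::field \<times> 'a \<times> 'a \<Rightarrow> 'a \<times> 'a \<times> 'a \<Rightarrow> 'a \<times> 'a \<times> 'a" where
  "lorentz_cross = (\<lambda>(l\<^sub>1, m\<^sub>1, n\<^sub>1) (l\<^sub>2, m\<^sub>2, n\<^sub>2).
     (m\<^sub>1 * n\<^sub>2 - n\<^sub>1 * m\<^sub>2, n\<^sub>1 * l\<^sub>2 - l\<^sub>1 * n\<^sub>2, m\<^sub>1 * l\<^sub>2 - l\<^sub>1 * m\<^sub>2))"

text \<open>Binet-Cauchy identity; the sign is opposite to the Euclidean one because
  \<open>bform\<close> has determinant -1.\<close>

lemma bform_lorentz_cross:
  "bform (lorentz_cross u v) (lorentz_cross s t) = bform u t * bform v s - bform u s * bform v t"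
  by (cases u, cases v, cases s, cases t) (simp add: bform_def lorentz_cross_def algebra_simps)

lemma bform_commute: "bform u v = bform v u"
  by (cases u, cases v) (simp add: bform_def mult.commute)

lemma bform_lorentz_cross_left: "bform (lorentz_cross u v) u = 0"
  and bform_lorentz_cross_right: "bform (lorentz_cross u v) v = 0"
  by (cases u, cases v, simp add: bform_def lorentz_cross_def algebra_simps)+

text \<open>The quotient is partial: self-proportionality singles out the vectors that represent a
  proportion.\<close>

lemma proportional_refl_iff: "proportional u u \<longleftrightarrow> u \<noteq> (0, 0, 0)"
  by (cases u) (auto simp: proportional_def intro: exI [of _ 1])

lemma abs_proportion_eq_iff:
  assumes "proportional u u" and "proportional v v"
  shows "abs_proportion u = abs_proportion v \<longleftrightarrow> proportional u v"
  using Quotient3_rel [OF Quotient3_proportion, of u v] assms by blast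

lemma lies_on_abs_proportion_iff:
  assumes "proportional u u" and "proportional v v"
  shows "lies_on (abs_proportion u) (abs_proportion v) \<longleftrightarrow> bform u v = 0"
  using assms by (cases u, cases v) (simp add: lies_on.abs_eq bform_def mult.commute)

lemma null_abs_proportion_iff:
  assumes "proportional u u"
  shows "null (abs_proportion u) \<longleftrightarrow> bform u u = 0"
  using assms by (cases u) (simp add: null.abs_eq bform_def power2_eq_square)

text \<open>If all three coordinates vanished, \<open>proportional_if_cross_zero\<close> would make
  \<open>u\<close> and \<open>v\<close> proportional.\<close>

lemma lorentz_cross_nonzero:
  assumes "proportional u u" and "proportional v v" and "\<not> proportional u v"
  shows "lorentz_cross u v \<noteq> (0, 0, 0)"
proof -
  obtain l\<^sub>1 m\<^sub>1 n\<^sub>1 l\<^sub>2 m\<^sub>2 n\<^sub>2 where uv: "u = (l\<^sub>1, m\<^sub>1, n\<^sub>1)" "v = (l\<^sub>2, m\<^sub>2, n\<^sub>2)"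
    by (cases u, cases v) auto
  show ?thesis
    using assms proportional_if_cross_zero [of l\<^sub>1 m\<^sub>1 n\<^sub>1 l\<^sub>2 m\<^sub>2 n\<^sub>2]
    by (auto simp: uv lorentz_cross_def proportional_refl_iff algebra_simps)
qed

text \<open>Incidence is orthogonality for \<open>bform\<close>, so the cross product lies on both
  lines; uniqueness of the common point does the rest.\<close>

lemma meet_abs_proportion:
  assumes "proportional u u" and "proportional v v" and "\<not> proportional u v"
  shows "meet (abs_proportion u) (abs_proportion v) = abs_proportion (lorentz_cross u v)"
  unfolding meet_def
proof (rule the1_equality)
  show "\<exists>!a. lies_on a (abs_proportion u) \<and> lies_on a (abs_proportion v)"
    using assms by (intro ex1_meet) (simp add: abs_proportion_eq_iff)
  have "proportional (lorentz_cross u v) (lorentz_cross u v)"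
    using assms by (simp add: lorentz_cross_nonzero proportional_refl_iff)
  with assms show "lies_on (abs_proportion (lorentz_cross u v)) (abs_proportion u)
      \<and> lies_on (abs_proportion (lorentz_cross u v)) (abs_proportion v)"
    by (simp add: lies_on_abs_proportion_iff bform_lorentz_cross_left bform_lorentz_cross_right)
qed

text \<open>The complements of the three spreads multiply to the square of
  \<open>d * e * f / (a * b * c)\<close>, so it suffices that the expression squared on the left is
  twice this quotient.\<close>

lemma spread_law_identity:
  fixes a b c d e f :: "'a::field"
  assumes "a \<noteq> 0" "b \<noteq> 0" "c \<noteq> 0" and nz: "a * b - d\<^sup>2 \<noteq> 0" "a * c - e\<^sup>2 \<noteq> 0"
    and S1: "S\<^sub>1 = 1 - f\<^sup>2 / (b * c)" and S2: "S\<^sub>2 = 1 - e\<^sup>2 / (a * c)" and S3: "S\<^sub>3 = 1 - d\<^sup>2 / (a * b)"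
    and q: "q = 1 - (a * f - d * e)\<^sup>2 / ((a * b - d\<^sup>2) * (a * c - e\<^sup>2))"
  shows "(S\<^sub>2 * S\<^sub>3 * q - S\<^sub>1 - S\<^sub>2 - S\<^sub>3 + 2)\<^sup>2 = 4 * (1 - S\<^sub>1) * (1 - S\<^sub>2) * (1 - S\<^sub>3)"
proof -
  have "S\<^sub>2 * S\<^sub>3 = (a * b - d\<^sup>2) * (a * c - e\<^sup>2) / (a\<^sup>2 * b * c)"
    using assms(1-3) by (simp add: S2 S3 divide_simps) (simp add: algebra_simps power2_eq_square)
  \<comment> \<open>The numerator of \<open>S\<^sub>2 * S\<^sub>3\<close> is the denominator of
    \<open>1 - q\<close>, and it cancels by \<open>nz\<close>.\<close>
  then have "S\<^sub>2 * S\<^sub>3 * (1 - q) = (a * f - d * e)\<^sup>2 / (a\<^sup>2 * b * c)"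
    using nz by (simp add: q)
  \<comment> \<open>Regrouping so that \<open>q\<close> enters only through the product just
    computed.\<close>
  moreover have "S\<^sub>2 * S\<^sub>3 * q - S\<^sub>1 - S\<^sub>2 - S\<^sub>3 + 2
      = (1 - S\<^sub>2) * (1 - S\<^sub>3) + (1 - S\<^sub>1) - S\<^sub>2 * S\<^sub>3 * (1 - q)"
    by (simp add: algebra_simps)
  \<comment> \<open>Over the denominator \<open>a\<^sup>2 * b * c\<close> the numerator is
    \<open>d\<^sup>2 * e\<^sup>2 + a\<^sup>2 * f\<^sup>2 - (a * f - d * e)\<^sup>2\<close>, that is
    \<open>2 * a * d * e * f\<close>.\<close>
  moreover have "(1 - S\<^sub>2) * (1 - S\<^sub>3) + (1 - S\<^sub>1) - (a * f - d * e)\<^sup>2 / (a\<^sup>2 * b * c)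
      = 2 * d * e * f / (a * b * c)"
    using assms(1-3) by (simp add: S1 S2 S3 divide_simps) (simp add: algebra_simps power2_eq_square)
  ultimately have "S\<^sub>2 * S\<^sub>3 * q - S\<^sub>1 - S\<^sub>2 - S\<^sub>3 + 2 = 2 * d * e * f / (a * b * c)"
    by simp
  then show ?thesis
    by (simp only:) (simp add: S1 S2 S3 power2_eq_square mult_ac)
qed

theorem theorem51:
  fixes L\<^sub>1 L\<^sub>2 L\<^sub>3 :: "'a::field line"
  assumes "CHAR('a) \<noteq> 2"
    and "L\<^sub>1 \<noteq> L\<^sub>2" and "L\<^sub>1 \<noteq> L\<^sub>3" and "L\<^sub>2 \<noteq> L\<^sub>3"
    and "\<not> null L\<^sub>1" and "\<not> null L\<^sub>2" and "\<not> null L\<^sub>3"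
    and "\<not> null (meet L\<^sub>1 L\<^sub>2)" and "\<not> null (meet L\<^sub>1 L\<^sub>3)"
    and "S\<^sub>1 = spread L\<^sub>2 L\<^sub>3" and "S\<^sub>2 = spread L\<^sub>1 L\<^sub>3" and "S\<^sub>3 = spread L\<^sub>1 L\<^sub>2"
    and "q\<^sub>1 = quadrance (meet L\<^sub>1 L\<^sub>2) (meet L\<^sub>1 L\<^sub>3)"
  shows "(S\<^sub>2 * S\<^sub>3 * q\<^sub>1 - S\<^sub>1 - S\<^sub>2 - S\<^sub>3 + 2)\<^sup>2 = 4 * (1 - S\<^sub>1) * (1 - S\<^sub>2) * (1 - S\<^sub>3)"
proof -
  obtain u v w where L: "L\<^sub>1 = abs_proportion u" "L\<^sub>2 = abs_proportion v" "L\<^sub>3 = abs_proportion w"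
    and uvw [simp]: "proportional u u" "proportional v v" "proportional w w"
    using Quotient3_abs_rep [OF Quotient3_proportion] Quotient3_rep_reflp [OF Quotient3_proportion]
    by metis
  have distinct: "\<not> proportional u v" "\<not> proportional u w"
    using assms(2,3) by (simp_all add: L abs_proportion_eq_iff)
  define p r where "p = lorentz_cross u v" and "r = lorentz_cross u w"
  have pr [simp]: "proportional p p" "proportional r r"
    using distinct by (simp_all add: p_def r_def proportional_refl_iff lorentz_cross_nonzero
        uvw [unfolded proportional_refl_iff])
  have meets: "meet L\<^sub>1 L\<^sub>2 = abs_proportion p" "meet L\<^sub>1 L\<^sub>3 = abs_proportion r"
    using distinct by (simp_all add: L p_def r_def meet_abs_proportion)
  have pp: "bform p p = - (bform u u * bform v v - (bform u v)\<^sup>2)"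
    and rr: "bform r r = - (bform u u * bform w w - (bform u w)\<^sup>2)"
    and prod: "bform p r = - (bform u u * bform v w - bform u v * bform u w)"
    by (simp_all add: p_def r_def bform_lorentz_cross power2_eq_square bform_commute [of v u]
        bform_commute [of w u])
  show ?thesis
  proof (rule spread_law_identity)
    show "bform u u \<noteq> 0" "bform v v \<noteq> 0" "bform w w \<noteq> 0"
      using assms(5-7) by (simp_all add: L null_abs_proportion_iff)
    \<comment> \<open>These Gram determinants are the negated norms of \<open>p\<close> and
      \<open>r\<close>, nonzero because the meets are non-null.\<close>
    show "bform u u * bform v v - (bform u v)\<^sup>2 \<noteq> 0" "bform u u * bform w w - (bform u w)\<^sup>2 \<noteq> 0"
      using assms(8,9) by (simp_all add: meets null_abs_proportion_iff pp rr)
    show "S\<^sub>1 = 1 - (bform v w)\<^sup>2 / (bform v v * bform w w)"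
      "S\<^sub>2 = 1 - (bform u w)\<^sup>2 / (bform u u * bform w w)"
      "S\<^sub>3 = 1 - (bform u v)\<^sup>2 / (bform u u * bform v v)"
      using assms(10-12) by (simp_all add: L spread.abs_eq)
    have "q\<^sub>1 = 1 - (bform p r)\<^sup>2 / (bform p p * bform r r)"
      using assms(13) by (simp add: meets quadrance.abs_eq)
    then show "q\<^sub>1 = 1 - (bform u u * bform v w - bform u v * bform u w)\<^sup>2
        / ((bform u u * bform v v - (bform u v)\<^sup>2) * (bform u u * bform w w - (bform u w)\<^sup>2))"
      \<comment> \<open>The minus signs cancel: one is squared, the other two multiply.\<close>
      by (simp only: pp rr prod power2_minus minus_mult_minus)
  qed
qed

end
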